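(* Let $n$ be a positive integer, let $G=A_n$ be the alternating group of degree $n$, let $R=\{(1\,2\,i)\mid i=3,\dots,n\}$ (a set of 3-cycles, empty if $n<3$), and let $S=R\cup R^{-1}$, where $R^{-1}=\{r^{-1}\mid r\in R\}$. Then the Cayley graph $\mathrm{Cay}(G,S)$ is integral, i.e. every eigenvalue of its adjacency matrix is an integer.
   Context: For a finite group $G$ and a subset $S\subseteq G$ with $1\notin S$ and $S=S^{-1}$, where $S^{-1}=\{s^{-1}\mid s\in S\}$, the Cayley graph $\mathrm{Cay}(G,S)$ is the undirected loopless graph with vertex set $G$ and edge set $\{(g,gs)\mid g\in G,\ s\in S\}$. Its adjacency matrix is the complex matrix $(a_{g,h})$ with rows and columns indexed by $G$, where $a_{g,h}=1$ if $(g,h)$ is an edge and $a_{g,h}=0$ otherwise. *)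

theory Defs
  imports
    "HOL-Algebra.Sym_Groups"
    "Graph_Theory.Pair_Digraph"
    "Jordan_Normal_Form.Char_Poly"
begin

text \<open>
  An undirected graph is, as in \<^theory>\<open>Graph_Theory.Digraph\<close>, a symmetric digraph; the lemma
  \<open>pair_graph_cayley_graph\<close> below shows that the usual conditions on the connection set make the
  Cayley graph a finite loopless graph in that sense.
\<close>

definition cayley_graph :: "('a, 'm) monoid_scheme \<Rightarrow> 'a set \<Rightarrow> 'a pair_pre_digraph" where
  "cayley_graph G S =
     \<lparr> pverts = carrier G, parcs = {(g, g \<otimes>\<^bsub>G\<^esub> s) | g s. g \<in> carrier G \<and> s \<in> S} \<rparr>"

text \<open>
  Matrices in \<^theory>\<open>Jordan_Normal_Form.Matrix\<close> are indexed by natural numbers, so the adjacency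
  matrix is taken with respect to an enumeration \<open>vs\<close> of the vertices.
\<close>

definition adjacency_matrix :: "'a pair_pre_digraph \<Rightarrow> 'a list \<Rightarrow> complex mat" where
  "adjacency_matrix \<Gamma> vs =
     mat (length vs) (length vs) (\<lambda>(i, j). if (vs ! i, vs ! j) \<in> parcs \<Gamma> then 1 else 0)"

text \<open>
  Different enumerations give matrices conjugate by a permutation matrix; integrality is
  required for all of them. Finiteness ensures that there is an enumeration.
\<close>

definition integral_graph :: "'a pair_pre_digraph \<Rightarrow> bool" where
  "integral_graph \<Gamma> \<longleftrightarrow>
     finite (pverts \<Gamma>) \<and>
     (\<forall>vs. distinct vs \<and> set vs = pverts \<Gamma> \<longrightarrow>
        (\<forall>k. eigenvalue (adjacency_matrix \<Gamma> vs) k \<longrightarrow> k \<in> \<int>))"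

lemma pair_graph_cayley_graph:
  fixes G (structure)
  assumes "group G" "finite (carrier G)" "S \<subseteq> carrier G" "\<one> \<notin> S" "set_inv S = S"
  shows "pair_graph (cayley_graph G S)"
proof -
  interpret group G by fact
  have S: "s \<in> carrier G" if "s \<in> S" for s
    using that assms(3) by (rule subsetD[rotated])
  have inv_S: "inv s \<in> S" if "s \<in> S" for s
  proof -
    have "inv s \<in> set_inv S" unfolding SET_INV_def by (rule UN_I[OF that]) simp
    then show ?thesis by (simp only: assms(5))
  qed
  have loop: "g \<noteq> g \<otimes> s" if "g \<in> carrier G" "s \<in> S" for g s
  proof
    assume "g = g \<otimes> s"
    then have "s = \<one>" using that S by (metis l_cancel_one)
    then show False using that(2) assms(4) by simp
  qed
  have parcs: "e \<in> parcs (cayley_graph G S) \<longleftrightarrow>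
      (\<exists>g s. e = (g, g \<otimes> s) \<and> g \<in> carrier G \<and> s \<in> S)" for e
    by (simp add: cayley_graph_def)
  have sub: "parcs (cayley_graph G S) \<subseteq> carrier G \<times> carrier G"
  proof
    fix e assume "e \<in> parcs (cayley_graph G S)"
    then obtain g s where "e = (g, g \<otimes> s)" "g \<in> carrier G" "s \<in> S"
      unfolding parcs by (elim exE conjE)
    then show "e \<in> carrier G \<times> carrier G" using S by simp
  qed
  have fin: "finite (parcs (cayley_graph G S))"
    using finite_subset[OF sub finite_cartesian_product[OF assms(2) assms(2)]] .
  have symm: "sym (parcs (cayley_graph G S))"
  proof (rule symI)
    fix a b assume "(a, b) \<in> parcs (cayley_graph G S)"
    then obtain s where s: "b = a \<otimes> s" "a \<in> carrier G" "s \<in> S"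
      unfolding parcs by (elim exE conjE) simp
    have "a = b \<otimes> inv s" using s S by (simp add: m_assoc)
    moreover have "b \<in> carrier G" using s S by simp
    ultimately show "(b, a) \<in> parcs (cayley_graph G S)"
      unfolding parcs using inv_S[OF s(3)] by (intro exI[of _ b] exI[of _ "inv s"]) simp
  qed
  show ?thesis
  proof
    show "finite (pverts (cayley_graph G S))"
      using assms(2) by (simp add: cayley_graph_def)
    show "finite (parcs (cayley_graph G S))" by (rule fin)
    show "Digraph.symmetric (with_proj (cayley_graph G S))"
      using symm by (simp add: symmetric_def arcs_ends_def arc_to_ends_def)
  next
    fix e assume e: "e \<in> parcs (cayley_graph G S)"
    then have "e \<in> carrier G \<times> carrier G" using sub by (rule subsetD[rotated])
    then show "fst e \<in> pverts (cayley_graph G S)" "snd e \<in> pverts (cayley_graph G S)"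
      by (simp_all add: cayley_graph_def mem_Times_iff)
    from e obtain g s where "e = (g, g \<otimes> s)" "g \<in> carrier G" "s \<in> S"
      unfolding parcs by (elim exE conjE)
    then show "fst e \<noteq> snd e" using loop by simp
  qed
qed

lemma connection_set:
  fixes n :: nat and R S :: "(nat \<Rightarrow> nat) set"
  assumes R_def: "R = {cycle_of_list [1, 2, i] | i. i \<in> {3..n}}"
    and S_def: "S = R \<union> set_inv\<^bsub>alt_group n\<^esub> R"
  shows "S \<subseteq> carrier (alt_group n)" "\<one>\<^bsub>alt_group n\<^esub> \<notin> S" "set_inv\<^bsub>alt_group n\<^esub> S = S"
proof -
  interpret A: group "alt_group n" by (rule alt_group_is_group)
  have S_iff: "s \<in> S \<longleftrightarrow> s \<in> R \<or> (\<exists>r\<in>R. s = inv\<^bsub>alt_group n\<^esub> r)" for s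
    by (simp add: S_def SET_INV_def)
  have R: "r \<in> carrier (alt_group n) \<and> r \<noteq> \<one>\<^bsub>alt_group n\<^esub>" if r: "r \<in> R" for r
  proof -
    obtain i where i: "r = cycle_of_list [1, 2, i]" "3 \<le> i" "i \<le> n"
      using r unfolding R_def by force
    have "r \<in> three_cycles n"
      unfolding i(1) using i(2,3) by (intro CollectI exI[of _ "[1, 2, i]"]) simp
    then have "r \<in> carrier (alt_group n)"
      by (rule subsetD[OF three_cycles_incl])
    moreover have "r 1 = 2" using i by (simp add: transpose_def)
    then have "r \<noteq> \<one>\<^bsub>alt_group n\<^esub>" by (auto simp: alt_group_one)
    ultimately show ?thesis by simp
  qed
  show S_carrier: "S \<subseteq> carrier (alt_group n)"
    using R A.inv_closed by (auto simp only: S_iff)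
  show "\<one>\<^bsub>alt_group n\<^esub> \<notin> S"
    unfolding S_iff using R A.inv_eq_1_iff by metis
  have closed: "inv\<^bsub>alt_group n\<^esub> s \<in> S" if "s \<in> S" for s
    using that unfolding S_iff using R A.inv_inv by metis
  show "set_inv\<^bsub>alt_group n\<^esub> S = S"
  proof
    show "set_inv\<^bsub>alt_group n\<^esub> S \<subseteq> S"
      unfolding SET_INV_def using closed by (intro UN_least) simp
    show "S \<subseteq> set_inv\<^bsub>alt_group n\<^esub> S"
    proof
      fix s assume s: "s \<in> S"
      then have "s = inv\<^bsub>alt_group n\<^esub> (inv\<^bsub>alt_group n\<^esub> s)"
        using A.inv_inv[OF subsetD[OF S_carrier s]] by (simp only:)
      then show "s \<in> set_inv\<^bsub>alt_group n\<^esub> S"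
        unfolding SET_INV_def using closed[OF s] by (intro UN_I[of "inv\<^bsub>alt_group n\<^esub> s"]) simp_all
    qed
  qed
qed

end

theory Submission
  imports Defs
begin

text \<open>
  Write \<open>c\<^sub>i = (1 2 i) = (1 2)(2 i)\<close>, so that \<open>c\<^sub>i\<inverse> = (1 2)(1 i)\<close>. Hence the connection set sums, in the
  group ring, to \<open>s (X + Y - s) = s (X + Y) - 1\<close>, where \<open>s = (1 2)\<close> commutes with \<open>X + Y\<close> and
  \<open>X = \<Sum>\<^sub>i (1 i)\<close>, \<open>Y = (1 2) + \<Sum>\<^sub>i (2 i)\<close> are consecutive Jucys--Murphy elements for the ordering
  \<open>3, \<dots>, n, 1, 2\<close>. These commute, so it suffices that each of them is annihilated by a product
  of linear factors \<open>T - k\<close> with integral \<open>k\<close>.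

  This follows by induction along the ordering. From \<open>X s = s Y - 1\<close> one finds that
  \<open>\<phi> = s (X - Y) + 1\<close> satisfies \<open>X \<phi> = \<phi> Y\<close> and \<open>\<phi>\<^sup>2 = 1 - (X - Y)\<^sup>2\<close>. Hence if \<open>p(X) = 0\<close> then
  \<open>(1 - (X - Y)\<^sup>2) p(Y) = 0\<close>, which means that on the image of \<open>p(Y)\<close> the element \<open>Y\<close> differs from
  \<open>X\<close> by \<open>1\<close> or \<open>-1\<close>, and so has integral eigenvalues as well.
\<close>

section \<open>Products of linear factors with integral roots\<close>

text \<open>Recording only the roots, repetition allowed, builds integrality in; integer shifts and
  concatenation become operations on lists.\<close>

definition linear_factors :: "int list \<Rightarrow> 'a :: ring_1 \<Rightarrow> 'a" where
  "linear_factors ks X = prod_list (map (\<lambda>k. X - of_int k) ks)"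

lemma linear_factors_Nil [simp]: "linear_factors [] X = 1"
  by (simp add: linear_factors_def)

lemma linear_factors_Cons [simp]:
  "linear_factors (k # ks) X = (X - of_int k) * linear_factors ks X"
  by (simp add: linear_factors_def)

lemma linear_factors_append:
  "linear_factors (ks @ ls) X = linear_factors ks X * linear_factors ls X"
  by (simp add: linear_factors_def)

lemma linear_factors_shift:
  "linear_factors ks (X + of_int c) = linear_factors (map (\<lambda>k. k - c) ks) X"
  by (induction ks) (simp_all add: algebra_simps)

text \<open>Integers are central, so \<open>Z\<close> passes through the factors one by one. Equal
  \<open>X\<close> and \<open>Y\<close> give commutation with \<open>Z\<close>.\<close>

lemma linear_factors_intertwine:
  fixes X Y Z :: "'a :: ring_1"
  assumes "X * Z = Z * Y"
  shows "linear_factors ks X * Z = Z * linear_factors ks Y"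
proof (induction ks)
  case (Cons k ks)
  have *: "(X - of_int k) * Z = Z * (Y - of_int k)"
    using assms by (simp add: algebra_simps mult_of_int_commute)
  have "linear_factors (k # ks) X * Z = (X - of_int k) * (Z * linear_factors ks Y)"
    by (simp add: Cons.IH mult.assoc)
  also have "\<dots> = Z * linear_factors (k # ks) Y"
    by (simp flip: mult.assoc add: *)
  finally show ?case .
qed simp

text \<open>If \<open>X\<close> and \<open>Y\<close> agree on \<open>u\<close>, they agree on
  \<open>P * u\<close> for every product \<open>P\<close> of linear factors in \<open>Y\<close>,
  since \<open>P\<close> commutes with both.\<close>

lemma linear_factors_cong_right:
  fixes X Y u :: "'a :: ring_1"
  assumes comm: "X * Y = Y * X" and eq: "X * u = Y * u"
  shows "linear_factors ks X * u = linear_factors ks Y * u"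
proof (induction ks)
  case (Cons k ks)
  define P where "P = linear_factors ks Y"
  have PX: "P * X = X * P" and PY: "P * Y = Y * P"
    unfolding P_def using comm by (simp_all add: linear_factors_intertwine)
  have "X * (P * u) = P * (X * u)" by (simp add: PX flip: mult.assoc)
  also have "\<dots> = Y * (P * u)" unfolding eq by (simp add: PY flip: mult.assoc)
  finally show ?case using Cons.IH by (simp add: P_def mult.assoc left_diff_distrib)
qed simp

lemma linear_factors_annihilate_step:
  fixes X Y s :: "'a :: ring_1"
  assumes torsion: "\<And>a :: 'a. a + a = 0 \<Longrightarrow> a = 0"
    and comm: "X * Y = Y * X" and s: "s * s = 1" and Xs: "X * s = s * Y - 1"
    and X0: "linear_factors ks X = 0"
  shows "\<exists>ls. linear_factors ls Y = 0"
proof -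
  have ss: "s * (s * a) = a" for a by (simp add: s flip: mult.assoc)
  have "s * (X * s) * s = s * (s * Y - 1) * s" by (simp add: Xs)
  then have "s * X = Y * s - 1"
    by (simp add: algebra_simps s ss)
  then have Ys: "Y * s = s * X + 1" by simp
  \<comment> \<open>Together with \<open>ss\<close>, these rules move \<open>s\<close> to the left
    and \<open>Y\<close> before \<open>X\<close>, a normal form that settles the identities for
    \<open>\<phi>\<close>.\<close>
  have Xs': "X * (s * a) = s * (Y * a) - a" and Ys': "Y * (s * a) = s * (X * a) + a"
    and comm': "X * (Y * a) = Y * (X * a)" for a
    by (simp_all add: Xs Ys comm algebra_simps flip: mult.assoc)
  define \<phi> where "\<phi> = s * (X - Y) + 1"
  define u where "u = linear_factors ks Y"
  have "X * \<phi> = \<phi> * Y"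
    by (simp add: \<phi>_def algebra_simps Xs' Ys' comm)
  from linear_factors_intertwine[OF this, of ks] have "\<phi> * u = 0"
    using X0 by (simp add: u_def)
  moreover have "\<phi> * \<phi> = 1 - (X - Y) * (X - Y)"
    by (simp add: \<phi>_def algebra_simps Xs' Ys' comm s ss)
  ultimately have quad: "(1 - (X - Y) * (X - Y)) * u = 0"
    by (metis mult.assoc mult_zero_right)
  \<comment> \<open>By \<open>quad\<close>, \<open>X - Y\<close> acts as 1 on \<open>u1\<close> and
    as -1 on \<open>u2\<close>. Their sum is \<open>u + u\<close>, so annihilating both annihilates
    \<open>u\<close> in the absence of 2-torsion.\<close>
  define u1 where "u1 = (1 + (X - Y)) * u"
  define u2 where "u2 = (1 - (X - Y)) * u"
  have "X * u1 = (Y + of_int 1) * u1" "X * u2 = (Y + of_int (- 1)) * u2"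
    using quad by (simp_all add: u1_def u2_def algebra_simps comm')
  moreover have "X * (Y + of_int c) = (Y + of_int c) * X" for c
    by (simp add: algebra_simps comm mult_of_int_commute)
  ultimately have "linear_factors ks (Y + of_int 1) * u1 = 0"
    "linear_factors ks (Y + of_int (- 1)) * u2 = 0"
    using linear_factors_cong_right X0 by (metis mult_zero_left)+
  then obtain ks1 ks2 where
    ks: "linear_factors ks1 Y * u1 = 0" "linear_factors ks2 Y * u2 = 0"
    unfolding linear_factors_shift by blast
  define P1 P2 where "P1 = linear_factors ks1 Y" and "P2 = linear_factors ks2 Y"
  have P: "P1 * P2 = P2 * P1"
    unfolding P1_def P2_def
    by (intro linear_factors_intertwine linear_factors_intertwine[symmetric]) simp
  have "P2 * P1 * u + P2 * P1 * u = P2 * P1 * (u1 + u2)"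
    by (simp add: u1_def u2_def algebra_simps)
  also have "\<dots> = P2 * (P1 * u1) + P1 * (P2 * u2)"
    by (simp add: distrib_left P flip: mult.assoc)
  also have "\<dots> = 0" using ks by (simp add: P1_def P2_def)
  finally have "P2 * P1 * u = 0" by (rule torsion)
  then have "linear_factors (ks2 @ ks1 @ ks) Y = 0"
    by (simp add: linear_factors_append P1_def P2_def u_def mult.assoc)
  then show ?thesis ..
qed

section \<open>The ring of linear operators on functions\<close>

text \<open>
  The ring \<^class>\<open>ring_1\<close> demands \<open>0 \<noteq> 1\<close>, so the operators act on the nonzero space of functions on
  a type rather than on an arbitrary module.
\<close>

typedef 'a fun_op = "{F :: ('a \<Rightarrow> complex) \<Rightarrow> 'a \<Rightarrow> complex.
    (\<forall>u v. F (\<lambda>x. u x + v x) = (\<lambda>x. F u x + F v x)) \<and>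
    (\<forall>c u. F (\<lambda>x. c * u x) = (\<lambda>x. c * F u x))}"
  morphisms app Fun_Op
  by (rule exI[of _ id]) simp

setup_lifting type_definition_fun_op

lemma app_add: "app T (\<lambda>x. u x + v x) = (\<lambda>x. app T u x + app T v x)"
  by transfer simp

lemma app_scale: "app T (\<lambda>x. c * u x) = (\<lambda>x. c * app T u x)"
  by transfer simp

lemma app_zero [simp]: "app T (\<lambda>x. 0) = (\<lambda>x. 0)"
  using app_scale[of T 0] by simp

instantiation fun_op :: (type) ring_1
begin

lift_definition zero_fun_op :: "'a fun_op" is "\<lambda>_ _. 0" by simp
lift_definition one_fun_op :: "'a fun_op" is "\<lambda>u. u" by simp
lift_definition plus_fun_op :: "'a fun_op \<Rightarrow> 'a fun_op \<Rightarrow> 'a fun_op"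
  is "\<lambda>F G u x. F u x + G u x" by (simp add: algebra_simps)
lift_definition minus_fun_op :: "'a fun_op \<Rightarrow> 'a fun_op \<Rightarrow> 'a fun_op"
  is "\<lambda>F G u x. F u x - G u x" by (simp add: algebra_simps)
lift_definition uminus_fun_op :: "'a fun_op \<Rightarrow> 'a fun_op"
  is "\<lambda>F u x. - F u x" by (simp add: algebra_simps)
lift_definition times_fun_op :: "'a fun_op \<Rightarrow> 'a fun_op \<Rightarrow> 'a fun_op"
  is "\<lambda>F G u. F (G u)" by simp

instance
proof
  show "(0 :: 'a fun_op) \<noteq> 1"
    by transfer (metis one_neq_zero)
qed (transfer; simp add: fun_eq_iff algebra_simps)+

end

lemma app_simps [simp]:
  "app 0 u = (\<lambda>x. 0)" "app 1 u = u"
  "app (S + T) u = (\<lambda>x. app S u x + app T u x)"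
  "app (S - T) u = (\<lambda>x. app S u x - app T u x)"
  "app (S * T) u = app S (app T u)"
  by (transfer; simp)+

lemma app_sum: "app (sum F A) u x = (\<Sum>i\<in>A. app (F i) u x)"
  by (induction A rule: infinite_finite_induct) simp_all

lemma app_of_int [simp]: "app (of_int k) u = (\<lambda>x. of_int k * u x)"
proof -
  have nat: "app (of_nat n) u = (\<lambda>x. of_nat n * u x)" for n
    by (induction n) (simp_all add: algebra_simps)
  show ?thesis
    using nat[of "nat k"] app_simps(4)[of 0 "of_nat (nat (- k))" u] nat[of "nat (- k)"]
    by (cases "k \<ge> 0") (simp_all add: of_nat_nat)
qed

lemma fun_op_torsion_free:
  fixes T :: "'a fun_op"
  assumes "T + T = 0"
  shows "T = 0"
  using assms by transfer (simp add: fun_eq_iff)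

text \<open>Applying the factors to \<open>u\<close> from the right, the last nonzero vector is an
  eigenvector. The invariant \<open>P\<close> confines it, for instance to an eigenspace of a
  commuting operator.\<close>

lemma linear_factors_eigenvector:
  assumes "app (linear_factors ks X) u = (\<lambda>x. 0)" and "u \<noteq> (\<lambda>x. 0)" and "P u"
    and inv: "\<And>k v. P v \<Longrightarrow> P (app (X - of_int k) v)"
  obtains w k where "w \<noteq> (\<lambda>x. 0)" "P w" "app X w = (\<lambda>x. of_int k * w x)"
  using assms(1-3)
proof (induction ks arbitrary: thesis)
  case (Cons k ks)
  have "P (app (linear_factors ks X) u)"
    using \<open>P u\<close> by (induction ks) (use inv in \<open>auto simp del: app_simps(4)\<close>)
  then show ?case
    using Cons by (cases "app (linear_factors ks X) u = (\<lambda>x. 0)") (auto simp: fun_eq_iff)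
qed auto

section \<open>Jucys--Murphy elements\<close>

text \<open>Right multiplication matches the edges \<open>(g, g s)\<close> and is multiplicative in
  \<open>p\<close> without inverses.\<close>

lift_definition translation :: "('a \<Rightarrow> 'a) \<Rightarrow> ('a \<Rightarrow> 'a) fun_op" is "\<lambda>p u g. u (g \<circ> p)"
  by simp

lemma app_translation [simp]: "app (translation p) u g = u (g \<circ> p)"
  by transfer simp

lemma translation_comp: "translation (p \<circ> q) = translation p * translation q"
  by transfer (simp add: comp_assoc)

lemma translation_id [simp]: "translation id = 1"
  by transfer simp

text \<open>The set \<open>A\<close> stands for the points preceding \<open>a\<close>, so no
  ordering has to be fixed.\<close>

definition jucys_murphy :: "'a set \<Rightarrow> 'a \<Rightarrow> ('a \<Rightarrow> 'a) fun_op" where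
  "jucys_murphy A a = (\<Sum>j\<in>A. translation (transpose j a))"

lemma jucys_murphy_insert:
  assumes "finite A" "b \<notin> A"
  shows "jucys_murphy (insert b A) a = translation (transpose b a) + jucys_murphy A a"
  using assms by (simp add: jucys_murphy_def)

lemma translation_jucys_murphy:
  assumes "inj p"
  shows "translation p * jucys_murphy A a = jucys_murphy (p ` A) (p a) * translation p"
proof -
  have "p \<circ> transpose j a = transpose (p j) (p a) \<circ> p" for j
    using assms by (auto simp: fun_eq_iff transpose_def inj_eq)
  then have "translation p * translation (transpose j a) =
      translation (transpose (p j) (p a)) * translation p" for j
    by (simp flip: translation_comp)
  moreover have "inj_on p A" using assms by (rule inj_on_subset) simp
  ultimately show ?thesis
    by (simp add: jucys_murphy_def sum_distrib_left sum_distrib_right sum.reindex)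
qed

lemma translation_jucys_murphy_transpose:
  assumes "a \<notin> A" "b \<notin> A"
  shows "translation (transpose b a) * jucys_murphy A a =
    jucys_murphy A b * translation (transpose b a)"
  using translation_jucys_murphy[OF inj_transpose[of b a], of A a] assms by simp

text \<open>Each transposition \<open>(j b)\<close> with \<open>j\<close> in \<open>A\<close>
  preserves \<open>insert b A\<close> and fixes \<open>a\<close>, so it commutes with the later
  element.\<close>

lemma jucys_murphy_commute:
  assumes "a \<notin> A" "a \<noteq> b"
  shows "jucys_murphy A b * jucys_murphy (insert b A) a =
    jucys_murphy (insert b A) a * jucys_murphy A b"
proof -
  have "translation (transpose j b) * jucys_murphy (insert b A) a =
      jucys_murphy (insert b A) a * translation (transpose j b)" if "j \<in> A" for j
  proof -
    have "transpose j b ` insert b A = insert b A"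
      using that by (intro transpose_image_eq) simp
    moreover have "transpose j b a = a"
      using that assms by (auto simp: transpose_def)
    ultimately show ?thesis
      using translation_jucys_murphy[OF inj_transpose[of j b], of "insert b A" a] by simp
  qed
  then show ?thesis
    by (simp add: jucys_murphy_def[of A b] sum_distrib_left sum_distrib_right)
qed

text \<open>Induction along the ordering: the empty sum is 0, and inserting \<open>b\<close> passes
  from the element at \<open>b\<close> over \<open>A\<close> to the next one, at
  \<open>a\<close>.\<close>

lemma jucys_murphy_integral:
  assumes "finite A" "a \<notin> A"
  shows "\<exists>ks. linear_factors ks (jucys_murphy A a) = 0"
  using assms
proof (induction A arbitrary: a)
  case empty
  show ?case by (intro exI[of _ "[0]"]) (simp add: jucys_murphy_def)
next
  case (insert b A)
  define s where "s = translation (transpose b a)"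
  have s: "s * s = 1"
    by (simp add: s_def flip: translation_comp)
  from insert.IH[OF insert.hyps(2)] obtain ks
    where ks: "linear_factors ks (jucys_murphy A b) = 0" ..
  \<comment> \<open>The next element is \<open>s + jucys_murphy A a\<close>; the 1 subtracted is
    \<open>s * s\<close>.\<close>
  have "jucys_murphy A b * s = s * jucys_murphy (insert b A) a - 1"
    using insert.hyps insert.prems s translation_jucys_murphy_transpose[of a A b]
    by (simp add: s_def jucys_murphy_insert distrib_left)
  then show ?case
    using insert.prems s ks
    by (intro linear_factors_annihilate_step[OF fun_op_torsion_free])
      (auto intro: jucys_murphy_commute)
qed

text \<open>A joint eigenvector of \<open>s\<close> and \<open>W\<close> has eigenvalues
  \<open>e\<close> and \<open>e * c\<close>, hence eigenvalue \<open>m = e * c + e\<close> for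
  \<open>X + Y = W + s\<close>. As \<open>X\<close> and \<open>Y\<close> commute and have integral
  eigenvalues, \<open>m\<close> is an integer.\<close>

lemma three_cycle_operator_eigenvalue_integral:
  fixes u :: "('a \<Rightarrow> 'a) \<Rightarrow> complex"
  assumes A: "finite A" "a \<notin> A" "b \<notin> A" "a \<noteq> b"
    and eigen: "app (translation (transpose a b) * (jucys_murphy A a + jucys_murphy A b)) u =
      (\<lambda>g. c * u g)"
    and u: "u \<noteq> (\<lambda>g. 0)"
  shows "c \<in> \<int>"
proof -
  define s where "s = translation (transpose a b)"
  define X where "X = jucys_murphy A a"
  define Y where "Y = jucys_murphy (insert a A) b"
  define W where "W = jucys_murphy A a + jucys_murphy A b"
  have s: "s * s = 1"
    by (simp add: s_def flip: translation_comp)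
  have XY: "X * Y = Y * X"
    unfolding X_def Y_def using A by (intro jucys_murphy_commute) auto
  have W: "W = X + Y - s"
    using A by (simp add: W_def X_def Y_def s_def jucys_murphy_insert)
  have sW: "s * W = W * s"
    using translation_jucys_murphy_transpose[of a A b] translation_jucys_murphy_transpose[of b A a] A
    by (simp add: s_def W_def distrib_left distrib_right transpose_commute add.commute)
  have ss: "app s (app s v) = v" for v
    using arg_cong[OF s, of "\<lambda>T. app T v"] by simp
  have eigen_u: "app s (app W u) = (\<lambda>g. c * u g)"
    using eigen by (simp add: s_def W_def)
  have Wu: "app W u = (\<lambda>g. c * app s u g)"
    using arg_cong[OF eigen_u, of "app s"] by (simp add: ss app_scale)
  have Wsu: "app W (app s u) = (\<lambda>g. c * u g)"
    using arg_cong[OF sW, of "\<lambda>T. app T u"] eigen_u by simp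
  \<comment> \<open>Either \<open>u\<close> is already in the -1 eigenspace of \<open>s\<close>, or
    \<open>u + s u\<close> is nonzero and fixed by \<open>s\<close>.\<close>
  obtain v e where v: "v \<noteq> (\<lambda>g. 0)" and e: "e * e = 1" "e \<in> \<int>"
    and sv: "app s v = (\<lambda>g. e * v g)" and Wv: "app W v = (\<lambda>g. e * c * v g)"
  proof (cases "app s u = (\<lambda>g. - 1 * u g)")
    case True
    show thesis
      by (rule that[of u "- 1"]) (use u True Wu in auto)
  next
    case False
    show thesis
    proof (rule that[of "\<lambda>g. u g + app s u g" 1])
      show "(\<lambda>g. u g + app s u g) \<noteq> (\<lambda>g. 0)"
        using False by (auto simp: fun_eq_iff add_eq_0_iff)
    qed (simp_all add: app_add ss Wu Wsu algebra_simps)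
  qed
  define m where "m = e * c + e"
  define P where "P = (\<lambda>w. app (X + Y) w = (\<lambda>g. m * w g))"
  have "X + Y = W + s" by (simp add: W)
  then have "P v"
    by (simp add: P_def sv Wv m_def algebra_simps)
  have P_inv: "P (app (X - of_int k) w)" if "P w" for k w
  proof -
    have "(X + Y) * (X - of_int k) = (X - of_int k) * (X + Y)"
      using XY by (simp add: algebra_simps mult_of_int_commute)
    then have "app (X + Y) (app (X - of_int k) w) = app (X - of_int k) (app (X + Y) w)"
      by (metis app_simps(5))
    then show ?thesis
      using that unfolding P_def by (simp only: app_scale)
  qed
  obtain ks where "linear_factors ks X = 0"
    using jucys_murphy_integral[of A a] A unfolding X_def by blast
  then obtain w k where w: "w \<noteq> (\<lambda>g. 0)" "P w" "app X w = (\<lambda>g. of_int k * w g)"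
    using linear_factors_eigenvector[of ks X v P] v \<open>P v\<close> P_inv by auto
  \<comment> \<open>On \<open>w\<close> the operator \<open>Y\<close> acts as \<open>m - k\<close>;
    its annihilating product forces this eigenvalue to be an integer \<open>l\<close>.\<close>
  define Q where "Q = (\<lambda>v. app Y v = (\<lambda>g. (m - of_int k) * v g))"
  have "Q w"
    using w(2,3) by (auto simp: P_def Q_def fun_eq_iff algebra_simps)
  have Q_inv: "Q (app (Y - of_int k) v)" if "Q v" for k v
  proof -
    have "Y * (Y - of_int k) = (Y - of_int k) * Y"
      by (simp add: algebra_simps mult_of_int_commute)
    then have "app Y (app (Y - of_int k) v) = app (Y - of_int k) (app Y v)"
      by (metis app_simps(5))
    then show ?thesis
      using that unfolding Q_def by (simp only: app_scale)
  qed
  obtain ls where "linear_factors ls Y = 0"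
    using jucys_murphy_integral[of "insert a A" b] A unfolding Y_def by blast
  then obtain x l where x: "x \<noteq> (\<lambda>g. 0)" "Q x" "app Y x = (\<lambda>g. of_int l * x g)"
    using linear_factors_eigenvector[of ls Y w Q] w(1) \<open>Q w\<close> Q_inv by auto
  obtain g where "x g \<noteq> 0"
    using x(1) by auto
  moreover have "(of_int k + of_int l) * x g = m * x g"
    using fun_cong[OF x(2)[unfolded Q_def], of g] fun_cong[OF x(3), of g]
    by (simp add: algebra_simps)
  ultimately have "m = of_int k + of_int l"
    by simp
  moreover have "c = e * m - 1"
    using e(1) by (simp add: m_def distrib_left flip: mult.assoc)
  ultimately show ?thesis using e(2) by simp
qed

section \<open>The adjacency matrix\<close>

lemma eigenvalue_adjacency_matrix_cayley_graph:
  fixes n :: nat and S :: "(nat \<Rightarrow> nat) set"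
  assumes vs: "distinct vs" "set vs = carrier (alt_group n)"
    and S: "S \<subseteq> carrier (alt_group n)" "finite S"
    and c: "eigenvalue (adjacency_matrix (cayley_graph (alt_group n) S) vs) c"
  obtains u where "u \<noteq> (\<lambda>g. 0)" "app (\<Sum>s\<in>S. translation s) u = (\<lambda>g. c * u g)"
proof -
  interpret G: group "alt_group n" by (rule alt_group_is_group)
  define M where "M = adjacency_matrix (cayley_graph (alt_group n) S) vs"
  have dim [simp]: "dim_row M = length vs" "dim_col M = length vs"
    by (simp_all add: M_def adjacency_matrix_def)
  from c obtain v where v: "v \<in> carrier_vec (length vs)" "v \<noteq> 0\<^sub>v (length vs)" "M *\<^sub>v v = c \<cdot>\<^sub>v v"
    unfolding eigenvalue_def eigenvector_def M_def[symmetric] by auto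
  \<comment> \<open>As \<open>vs\<close> is distinct, the sum has at most one nonzero term:
    \<open>v\<close> is extended by zero outside the group.\<close>
  define u where "u g = (\<Sum>j<length vs. if vs ! j = g then v $ j else 0)" for g
  have u_nth: "u (vs ! i) = v $ i" if "i < length vs" for i
  proof -
    have "u (vs ! i) = (\<Sum>j<length vs. if j = i then v $ j else 0)"
      unfolding u_def using that vs(1) by (intro sum.cong) (auto simp: nth_eq_iff_index_eq)
    then show ?thesis using that by simp
  qed
  have u_outside: "u g = 0" if "g \<notin> carrier (alt_group n)" for g
  proof -
    have "vs ! j \<noteq> g" if "j < length vs" for j
      using that \<open>g \<notin> carrier (alt_group n)\<close> vs(2) nth_mem by blast
    then show ?thesis by (simp add: u_def)
  qed
  have "(\<Sum>s\<in>S. u (g \<circ> s)) = c * u g" for g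
  proof (cases "g \<in> carrier (alt_group n)")
    case True
    then obtain i where i: "i < length vs" "g = vs ! i"
      using vs(2) by (metis in_set_conv_nth)
    \<comment> \<open>Left cancellation of the injective \<open>g\<close> leaves at most one
      \<open>s\<close> leading from \<open>g\<close> to \<open>vs ! j\<close>.\<close>
    have edge: "(\<Sum>s\<in>S. if vs ! j = g \<circ> s then v $ j else 0) = M $$ (i, j) * v $ j"
      if "j < length vs" for j
    proof (cases "\<exists>s\<in>S. vs ! j = g \<circ> s")
      case s: True
      then obtain s where s: "s \<in> S" "vs ! j = g \<circ> s" by blast
      have "inj g" using True by (auto simp: alt_group_carrier permutes_inj)
      then have "s' = s" if "vs ! j = g \<circ> s'" for s'
        using that s(2) by (simp add: fun_eq_iff inj_eq)
      then have "(\<Sum>s'\<in>S. if vs ! j = g \<circ> s' then v $ j else 0) =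
          (\<Sum>s'\<in>S. if s' = s then v $ j else 0)"
        using s by (intro sum.cong) auto
      moreover have "(g, vs ! j) \<in> parcs (cayley_graph (alt_group n) S)"
        using s True by (auto simp: cayley_graph_def alt_group_mult)
      ultimately show ?thesis
        using s S(2) i that by (simp add: M_def adjacency_matrix_def)
    next
      case False
      then have "(g, vs ! j) \<notin> parcs (cayley_graph (alt_group n) S)"
        by (auto simp: cayley_graph_def alt_group_mult)
      moreover have "(\<Sum>s\<in>S. if vs ! j = g \<circ> s then v $ j else 0) = 0"
        using False by (intro sum.neutral) auto
      ultimately show ?thesis
        using i that by (simp add: M_def adjacency_matrix_def)
    qed
    have "(\<Sum>s\<in>S. u (g \<circ> s)) = (\<Sum>j<length vs. \<Sum>s\<in>S. if vs ! j = g \<circ> s then v $ j else 0)"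
      unfolding u_def by (rule sum.swap)
    also have "\<dots> = (\<Sum>j<length vs. M $$ (i, j) * v $ j)"
      by (intro sum.cong refl edge) simp
    also have "\<dots> = (M *\<^sub>v v) $ i"
      using i v(1) by (simp add: scalar_prod_def atLeast0LessThan)
    also have "\<dots> = c * u g"
      using i v(1,3) by (simp add: u_nth)
    finally show ?thesis .
  next
    case False
    \<comment> \<open>Right multiplication by a group element cannot lead into the group from
      outside, so both sides vanish.\<close>
    have "g \<circ> s \<notin> carrier (alt_group n)" if "s \<in> S" for s
    proof
      assume gs: "g \<circ> s \<in> carrier (alt_group n)"
      have s: "s \<in> carrier (alt_group n)" using that S(1) by blast
      have "(g \<circ> s) \<circ> inv' s \<in> carrier (alt_group n)"
        using G.m_closed[OF gs alt_group_inv_closed[OF s]] by (simp add: alt_group_mult)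
      moreover have "(g \<circ> s) \<circ> inv' s = g"
        using s permutes_inv_o(1)[of s "{1..n}"] by (simp add: alt_group_carrier comp_assoc)
      ultimately show False using False by simp
    qed
    then show ?thesis using False by (simp add: u_outside)
  qed
  moreover have "u \<noteq> (\<lambda>g. 0)"
  proof
    assume "u = (\<lambda>g. 0)"
    then have "v = 0\<^sub>v (length vs)" using v(1) u_nth by (intro eq_vecI) auto
    then show False using v(2) by simp
  qed
  ultimately show thesis
    using that[of u] by (simp add: fun_eq_iff app_sum)
qed

lemma sum_three_cycle_translations:
  fixes n :: nat and R S :: "(nat \<Rightarrow> nat) set"
  assumes R: "R = {cycle_of_list [1, 2, i] | i. i \<in> {3..n}}"
    and S: "S = R \<union> set_inv\<^bsub>alt_group n\<^esub> R"
  shows "(\<Sum>s\<in>S. translation s) =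
    translation (transpose 1 2) * (jucys_murphy {3..n} 1 + jucys_murphy {3..n} 2)"
proof -
  define p q :: "nat \<Rightarrow> nat \<Rightarrow> nat"
    where "p i = transpose 1 2 \<circ> transpose i 2" and "q i = transpose 1 2 \<circ> transpose i 1" for i
  have R_eq: "R = p ` {3..n}"
    by (auto simp: R p_def transpose_commute)
  have inv: "inv\<^bsub>alt_group n\<^esub> p i = q i" if "i \<in> {3..n}" for i
  proof -
    have "p i \<in> carrier (alt_group n)"
      using connection_set(1)[OF R S] that unfolding S R_eq by blast
    then have "inv\<^bsub>alt_group n\<^esub> p i = inv' (p i)" by (rule alt_group_inv_equality)
    also have "\<dots> = q i"
      using that by (intro inv_unique_comp) (auto simp: p_def q_def fun_eq_iff transpose_def)
    finally show ?thesis .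
  qed
  have S_eq: "S = p ` {3..n} \<union> q ` {3..n}"
    using inv by (auto simp: S R_eq SET_INV_def)
  \<comment> \<open>The first two values recover \<open>i\<close>; the image of 1 separates the two
    families, being 2 for \<open>p\<close> and at least 3 for \<open>q\<close>.\<close>
  have "p i 2 = i" "q i 1 = i" "p i 1 = 2" if "i \<in> {3..n}" for i
    using that by (auto simp: p_def q_def transpose_def)
  then have "inj_on p {3..n}" "inj_on q {3..n}" "p ` {3..n} \<inter> q ` {3..n} = {}"
    by (metis inj_onI, metis inj_onI, fastforce)
  then have "(\<Sum>s\<in>S. translation s) =
      (\<Sum>i\<in>{3..n}. translation (p i)) + (\<Sum>i\<in>{3..n}. translation (q i))"
    by (simp add: S_eq sum.union_disjoint sum.reindex)
  then show ?thesis
    by (simp add: p_def q_def translation_comp jucys_murphy_def sum_distrib_left distrib_left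
        add.commute)
qed

theorem mainTheorem4:
  fixes n :: nat and R S :: "(nat \<Rightarrow> nat) set"
  assumes "n > 0"
    and "R = {cycle_of_list [1, 2, i] | i. i \<in> {3..n}}"
    and "S = R \<union> set_inv\<^bsub>alt_group n\<^esub> R"
  shows "integral_graph (cayley_graph (alt_group n) S)"
proof -
  have fin: "finite (carrier (alt_group n))"
    by (rule finite_subset[OF _ finite_permutations[of "{1..n}"]]) (auto simp: alt_group_carrier)
  have S: "S \<subseteq> carrier (alt_group n)"
    by (rule connection_set(1)[OF assms(2,3)])
  have "c \<in> \<int>"
    if vs: "distinct vs" "set vs = carrier (alt_group n)"
      "eigenvalue (adjacency_matrix (cayley_graph (alt_group n) S) vs) c" for vs c
  proof -
    obtain u where "u \<noteq> (\<lambda>g. 0)" "app (\<Sum>s\<in>S. translation s) u = (\<lambda>g. c * u g)"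
      using eigenvalue_adjacency_matrix_cayley_graph[OF vs(1,2) S finite_subset[OF S fin] vs(3)] .
    then show ?thesis
      unfolding sum_three_cycle_translations[OF assms(2,3)]
      by (intro three_cycle_operator_eigenvalue_integral[of "{3..n}" 1 2 u c]) auto
  qed
  then show ?thesis
    using fin by (auto simp: integral_graph_def cayley_graph_def)
qed

end
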